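(* For every $N\ge1$, let $\mathrm{OR}:\{0,1\}^N\to\{0,1\}$ be $\mathrm{OR}(X)=x_0\vee\cdots\vee x_{N-1}$. Then $Q_0(\mathrm{OR})=N$.
   Context: Quantum networks: the input $X=(x_0,\ldots,x_{N-1})\in\{0,1\}^N$ is given as a black-box. A quantum network with $T$ queries acts on $m$ qubits (for some $m$) and is a sequence of unitary transformations $U_0,O,U_1,O,\ldots,U_{T-1},O,U_T$ applied in this order to the initial state $|0\rangle$, where the $U_j$ are arbitrary unitaries on $m$ qubits not depending on $X$, and the query $O$ (depending on $X$) maps each basis state $|i,b,z\rangle$ to $|i,b\oplus x_i,z\rangle$; here $i$ consists of $\lceil\log_2 N\rceil$ bits, $b$ is one bit, and $z$ consists of the remaining $m-\lceil\log_2 N\rceil-1$ bits (if $i\ge N$, the query leaves the basis state unchanged). Zero-error computation: the output is obtained by measuring the two rightmost bits of the final state in the computational basis. If the first of these two bits is 0 the answer is "inconclusive"; otherwise the second bit is the answer. The network computes $f$ with zero error if for every $X\in\{0,1\}^N$ the answer, whenever it is not "inconclusive", equals $f(X)$ with certainty, and the probability of "inconclusive" is less than $1/2$. $Q_0(f)$ is the minimum $T$ such that some quantum network with $T$ queries computes $f$ with zero error. *)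

theory Defs
  imports
    Complex_Main
    "HOL-Library.Log_Nat"
    "Jordan_Normal_Form.Schur_Decomposition"
begin

text \<open>
  States of \<open>m\<close> qubits are complex vectors of dimension \<open>2 ^ m\<close>. The basis state
  \<open>|s\<rangle>\<close> with \<open>s\<close> read as an \<open>m\<close>-bit binary number is the unit vector with index \<open>s\<close>;
  the leftmost qubit is the most significant bit, so the rightmost qubit is \<open>bit s 0\<close>.
  Black-box inputs \<open>X = (x_0, ..., x_{N-1})\<close> are Boolean lists of length \<open>N\<close>.
\<close>

definition unitary_mat :: "nat \<Rightarrow> complex mat \<Rightarrow> bool" where
  "unitary_mat n U \<longleftrightarrow>
     U \<in> carrier_mat n n \<and> mat_adjoint U * U = 1\<^sub>m n \<and> U * mat_adjoint U = 1\<^sub>m n"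

definition work_bits :: "nat \<Rightarrow> nat \<Rightarrow> nat" where
  "work_bits N m = m - ceillog2 N - 1"

text \<open>
  For \<open>s = |i, b, z\<rangle>\<close> with \<open>w\<close> work bits, \<open>b\<close> is the bit of \<open>s\<close> at position \<open>w\<close> and
  \<open>i = s div 2 ^ Suc w\<close>.
\<close>

definition query_index :: "nat \<Rightarrow> nat \<Rightarrow> bool list \<Rightarrow> nat \<Rightarrow> nat" where
  "query_index N m X s =
     (let w = work_bits N m; i = s div 2 ^ Suc w
      in if i < N \<and> X ! i then flip_bit w s else s)"

definition query_mat :: "nat \<Rightarrow> nat \<Rightarrow> bool list \<Rightarrow> complex mat" where
  "query_mat N m X =
     mat (2 ^ m) (2 ^ m) (\<lambda>(r, s). if r = query_index N m X s then 1 else 0)"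

definition ket :: "nat \<Rightarrow> nat \<Rightarrow> nat \<Rightarrow> bool \<Rightarrow> nat \<Rightarrow> complex vec" where
  "ket N m i b z =
     unit_vec (2 ^ m) (i * 2 ^ Suc (work_bits N m) + of_bool b * 2 ^ work_bits N m + z)"

lemma query_mat_ket:
  assumes m: "ceillog2 N + 1 \<le> m" and i: "i < 2 ^ ceillog2 N" and z: "z < 2 ^ work_bits N m"
  shows "query_mat N m X *\<^sub>v ket N m i b z =
           ket N m i (if i < N then b \<noteq> X ! i else b) z"
proof -
  define w where "w = work_bits N m"
  define s where "s b = i * 2 ^ Suc w + of_bool b * 2 ^ w + z" for b
  have zw: "z < 2 ^ w" using z by (simp add: w_def)
  have mw: "m = ceillog2 N + Suc w" using m by (simp add: w_def work_bits_def)
  have low: "of_bool b * 2 ^ w + z < 2 ^ Suc w" for b using zw by (cases b) auto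
  have div: "s b div 2 ^ Suc w = i" for b
  proof -
    have "s b = (of_bool b * 2 ^ w + z) + i * 2 ^ Suc w" by (simp add: s_def)
    thus ?thesis using low[of b] by (simp del: power_Suc)
  qed
  have bnd: "s b < 2 ^ m" for b
  proof -
    have "s b div 2 ^ Suc w < 2 ^ ceillog2 N" using div i by simp
    thus ?thesis by (simp add: mw power_add less_mult_imp_div_less div_less_iff_less_mult del: power_Suc)
  qed
  have bits: "bit (s b) w = b" for b
  proof -
    have "s b = z + (2 * i + of_bool b) * 2 ^ w" by (simp add: s_def algebra_simps)
    hence "s b div 2 ^ w = 2 * i + of_bool b" using zw by simp
    thus ?thesis by (simp add: bit_iff_odd)
  qed
  have flip: "flip_bit w (s b) = s (\<not> b)" for b
  proof (cases b)
    case True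
    have "set_bit w (s False) = s True"
      using bits[of False] by (simp add: set_bit_eq s_def)
    hence "unset_bit w (s True) = unset_bit w (set_bit w (s False))" by simp
    also have "\<dots> = s False"
      using bits[of False] by (intro bit_eqI) (auto simp: bit_simps)
    finally show ?thesis using True bits by (simp add: flip_bit_eq_if)
  next
    case False
    thus ?thesis using bits[of False] by (simp add: flip_bit_eq_if set_bit_eq s_def)
  qed
  have qi: "query_index N m X (s b) = s (if i < N then b \<noteq> X ! i else b)"
    unfolding query_index_def Let_def w_def[symmetric] div using flip by auto
  have "query_mat N m X *\<^sub>v unit_vec (2 ^ m) (s b) =
          unit_vec (2 ^ m) (s (if i < N then b \<noteq> X ! i else b))"
    by (rule eq_vecI) (use bnd in \<open>auto simp: query_mat_def qi unit_vec_def scalar_prod_def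
        if_distrib[where f = "\<lambda>x. _ * x"] cong: if_cong\<close>)
  thus ?thesis by (simp add: ket_def s_def w_def)
qed

text \<open>\<open>run_network N m U X T = U T * O * U (T - 1) * ... * U 1 * O * U 0 |0\<rangle>\<close>\<close>

fun run_network :: "nat \<Rightarrow> nat \<Rightarrow> (nat \<Rightarrow> complex mat) \<Rightarrow> bool list \<Rightarrow> nat \<Rightarrow> complex vec" where
  "run_network N m U X 0 = U 0 *\<^sub>v unit_vec (2 ^ m) 0"
| "run_network N m U X (Suc t) =
     U (Suc t) *\<^sub>v (query_mat N m X *\<^sub>v run_network N m U X t)"

text \<open>Both the query registers and the two output qubits must be present.\<close>

definition quantum_network :: "nat \<Rightarrow> nat \<Rightarrow> nat \<Rightarrow> (nat \<Rightarrow> complex mat) \<Rightarrow> bool" where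
  "quantum_network N T m U \<longleftrightarrow>
     ceillog2 N + 1 \<le> m \<and> 2 \<le> m \<and> (\<forall>j\<le>T. unitary_mat (2 ^ m) (U j))"

definition measure_prob :: "nat \<Rightarrow> complex vec \<Rightarrow> (nat \<Rightarrow> bool) \<Rightarrow> real" where
  "measure_prob m \<psi> E = (\<Sum>s\<in>{s. s < 2 ^ m \<and> E s}. (cmod (\<psi> $ s))\<^sup>2)"

definition prob_inconclusive :: "nat \<Rightarrow> complex vec \<Rightarrow> real" where
  "prob_inconclusive m \<psi> = measure_prob m \<psi> (\<lambda>s. \<not> bit s 1)"

definition prob_answer :: "nat \<Rightarrow> complex vec \<Rightarrow> bool \<Rightarrow> real" where
  "prob_answer m \<psi> a = measure_prob m \<psi> (\<lambda>s. bit s 1 \<and> bit s 0 = a)"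

definition computes_zero_error ::
    "nat \<Rightarrow> nat \<Rightarrow> nat \<Rightarrow> (nat \<Rightarrow> complex mat) \<Rightarrow> (bool list \<Rightarrow> bool) \<Rightarrow> bool" where
  "computes_zero_error N T m U f \<longleftrightarrow>
     (\<forall>X. length X = N \<longrightarrow>
        prob_answer m (run_network N m U X T) (\<not> f X) = 0 \<and>
        prob_inconclusive m (run_network N m U X T) < 1 / 2)"

definition Q0 :: "nat \<Rightarrow> (bool list \<Rightarrow> bool) \<Rightarrow> nat" where
  "Q0 N f = (LEAST T. \<exists>m U. quantum_network N T m U \<and> computes_zero_error N T m U f)"

definition OR :: "bool list \<Rightarrow> bool" where
  "OR X \<longleftrightarrow> (\<exists>i<length X. X ! i)"

end

theory Submission
  imports Defs
begin

text \<open>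
  Lower bound: after \<open>t\<close> queries every amplitude is a multilinear polynomial of degree at most \<open>t\<close>
  in the input bits. If \<open>T < N\<close>, an amplitude of a basis state answering 0 vanishes on all nonzero
  inputs, and since its alternating sum over the cube is zero, it also vanishes at the zero input.
  There the answer is therefore inconclusive with probability 1.

  Upper bound: a reversible classical computation reads the bits one after the other and shifts
  them into the work register. The final register content is nonzero iff \<open>OR X\<close>.
\<close>

section \<open>Degree of functions on the Boolean cube\<close>

text \<open>Degree at most \<open>d\<close>, expressed without polynomials: the mixed differences along more than
  \<open>d\<close> coordinates vanish. A point of the cube is the set of its coordinates equal to 1.\<close>

definition degree_le :: "nat \<Rightarrow> ('a set \<Rightarrow> 'b::comm_ring_1) \<Rightarrow> bool" where
  "degree_le d g \<longleftrightarrow>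
     (\<forall>A S. finite S \<longrightarrow> A \<inter> S = {} \<longrightarrow> d < card S \<longrightarrow>
        (\<Sum>Y\<in>Pow S. (-1) ^ card Y * g (A \<union> Y)) = 0)"

lemma degree_leD:
  "degree_le d g \<Longrightarrow> finite S \<Longrightarrow> A \<inter> S = {} \<Longrightarrow> d < card S \<Longrightarrow>
     (\<Sum>Y\<in>Pow S. (-1) ^ card Y * g (A \<union> Y)) = 0"
  by (simp add: degree_le_def)

text \<open>Subsets of \<open>insert i S\<close> are paired as \<open>Y\<close> and
  \<open>insert i Y\<close>, with opposite signs. This is the recursion of mixed differences: the
  one along \<open>insert i S\<close> is a difference of two along \<open>S\<close>, with base
  points \<open>A\<close> and \<open>insert i A\<close>.\<close>

lemma alternating_sum_insert:
  fixes g :: "'a set \<Rightarrow> 'b::comm_ring_1"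
  assumes "finite S" "i \<notin> S"
  shows "(\<Sum>Y\<in>Pow (insert i S). (-1) ^ card Y * g (A \<union> Y)) =
    (\<Sum>Y\<in>Pow S. (-1) ^ card Y * g (A \<union> Y)) - (\<Sum>Y\<in>Pow S. (-1) ^ card Y * g (insert i A \<union> Y))"
proof -
  have inj: "inj_on (insert i) (Pow S)"
    using assms by (auto simp: inj_on_def insert_ident)
  have fin: "finite Y" if "Y \<in> Pow S" for Y
    using that assms finite_subset by auto
  have "(\<Sum>Y\<in>insert i ` Pow S. (-1) ^ card Y * g (A \<union> Y)) =
      (\<Sum>Y\<in>Pow S. (-1) ^ card (insert i Y) * g (A \<union> insert i Y))"
    using inj by (simp add: sum.reindex)
  also have "\<dots> = (\<Sum>Y\<in>Pow S. - ((-1) ^ card Y * g (insert i A \<union> Y)))"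
  proof (rule sum.cong[OF refl])
    fix Y assume Y: "Y \<in> Pow S"
    hence "i \<notin> Y" using assms by auto
    thus "(-1) ^ card (insert i Y) * g (A \<union> insert i Y) = - ((-1) ^ card Y * g (insert i A \<union> Y))"
      using fin[OF Y] by simp
  qed
  finally have image: "(\<Sum>Y\<in>insert i ` Pow S. (-1) ^ card Y * g (A \<union> Y)) =
      - (\<Sum>Y\<in>Pow S. (-1) ^ card Y * g (insert i A \<union> Y))"
    by (simp add: sum_negf)
  have "Pow S \<inter> insert i ` Pow S = {}" using assms by auto
  thus ?thesis
    using assms by (simp add: Pow_insert sum.union_disjoint image)
qed

lemma degree_le_const: "degree_le 0 (\<lambda>_. c)"
  unfolding degree_le_def
proof (intro allI impI)
  fix A S :: "'a set"
  assume S: "finite S" "0 < card S"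
  then obtain i where "i \<in> S" by fastforce
  then obtain S' where "S = insert i S'" "i \<notin> S'" by (rule Set.set_insert)
  with S show "(\<Sum>Y\<in>Pow S. (-1) ^ card Y * c) = 0"
    using alternating_sum_insert[of S' i "\<lambda>_. c"] by simp
qed

text \<open>Mixed differences are linear in the function. The coefficients \<open>c j\<close> are
  constant on the cube, so this covers matrices that do not depend on the input.\<close>

lemma degree_le_sum:
  fixes g :: "'j \<Rightarrow> 'a set \<Rightarrow> 'b::comm_ring_1"
  assumes "\<And>j. j \<in> J \<Longrightarrow> degree_le d (g j)"
  shows "degree_le d (\<lambda>A. \<Sum>j\<in>J. c j * g j A)"
  unfolding degree_le_def
proof (intro allI impI)
  fix A S :: "'a set"
  assume S: "finite S" "A \<inter> S = {}" "d < card S"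
  have "(\<Sum>Y\<in>Pow S. (-1) ^ card Y * (\<Sum>j\<in>J. c j * g j (A \<union> Y))) =
      (\<Sum>j\<in>J. c j * (\<Sum>Y\<in>Pow S. (-1) ^ card Y * g j (A \<union> Y)))"
    unfolding sum_distrib_left by (subst sum.swap) (simp add: mult.left_commute)
  also have "\<dots> = 0"
    using degree_leD[OF assms S] by simp
  finally show "(\<Sum>Y\<in>Pow S. (-1) ^ card Y * (\<Sum>j\<in>J. c j * g j (A \<union> Y))) = 0" .
qed

lemma degree_le_mult_const:
  assumes "degree_le d g"
  shows "degree_le d (\<lambda>A. c * g A)"
proof -
  have "degree_le d (\<lambda>A. \<Sum>j\<in>{()}. c * g A)"
    using assms by (rule degree_le_sum)
  thus ?thesis by simp
qed

text \<open>As a polynomial the function is x_i g + (1 - x_i) h, whence the extra degree. It models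
  a query, whose action on a basis state is governed by one input bit.\<close>

lemma degree_le_If_mem:
  assumes g: "degree_le d g" and h: "degree_le d h"
  shows "degree_le (Suc d) (\<lambda>A. if i \<in> A then g A else h A)"
  unfolding degree_le_def
proof (intro allI impI)
  fix A S :: "'a set"
  assume S: "finite S" "A \<inter> S = {}" "Suc d < card S"
  let ?k = "\<lambda>A. if i \<in> A then g A else h A"
  show "(\<Sum>Y\<in>Pow S. (-1) ^ card Y * ?k (A \<union> Y)) = 0"
  proof (cases "i \<in> S")
    case True
    then obtain S' where S': "S = insert i S'" "i \<notin> S'" by (rule Set.set_insert)
    have fin: "finite S'" and card: "d < card S'" and iA: "i \<notin> A" and disj: "A \<inter> S' = {}"
      using S S' by auto
    \<comment> \<open>Splitting along \<open>i\<close> fixes the branch in each half, and the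
      remaining \<open>S'\<close> still has more than \<open>d\<close> elements.\<close>
    have "(\<Sum>Y\<in>Pow S'. (-1) ^ card Y * ?k (A \<union> Y)) = (\<Sum>Y\<in>Pow S'. (-1) ^ card Y * h (A \<union> Y))"
      using S' iA by (intro sum.cong) auto
    also have "\<dots> = 0"
      using degree_leD[OF h fin disj card] .
    moreover have "(\<Sum>Y\<in>Pow S'. (-1) ^ card Y * ?k (insert i A \<union> Y)) =
        (\<Sum>Y\<in>Pow S'. (-1) ^ card Y * g (insert i A \<union> Y))"
      by (intro sum.cong) auto
    moreover have "\<dots> = 0"
      using S' disj by (intro degree_leD[OF g fin _ card]) auto
    ultimately show ?thesis
      unfolding S'(1) alternating_sum_insert[OF fin S'(2), of ?k] by simp
  next
    case False
    \<comment> \<open>All points \<open>A \<union> Y\<close> agree in coordinate \<open>i\<close>,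
      so one branch applies throughout.\<close>
    have "(\<Sum>Y\<in>Pow S. (-1) ^ card Y * ?k (A \<union> Y)) =
        (\<Sum>Y\<in>Pow S. (-1) ^ card Y * (if i \<in> A then g else h) (A \<union> Y))"
      using False by (intro sum.cong) auto
    also have "\<dots> = 0"
      using g h S by (auto intro: degree_leD)
    finally show ?thesis .
  qed
qed

text \<open>The degree bound makes the alternating sum over the subsets of \<open>S\<close> zero,
  and only the term of the empty set is left in it.\<close>

lemma degree_le_vanish_at_empty:
  assumes "degree_le d g" "finite S" "d < card S"
    and zero: "\<And>A. A \<subseteq> S \<Longrightarrow> A \<noteq> {} \<Longrightarrow> g A = 0"
  shows "g {} = 0"
proof -
  have "0 = (\<Sum>Y\<in>Pow S. (-1) ^ card Y * g Y)"
    using degree_leD[of d g S "{}"] assms by simp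
  also have "\<dots> = (\<Sum>Y\<in>{{}}. (-1) ^ card Y * g Y)"
    using assms by (intro sum.mono_neutral_right) auto
  finally show ?thesis by simp
qed

section \<open>Lower bound\<close>

lemma mult_mat_vec_nth:
  assumes "M \<in> carrier_mat n k" "v \<in> carrier_vec k" "r < n"
  shows "(M *\<^sub>v v) $ r = (\<Sum>s<k. M $$ (r, s) * v $ s)"
proof -
  have "(M *\<^sub>v v) $ r = row M r \<bullet> v"
    using assms by simp
  also have "\<dots> = (\<Sum>s<k. M $$ (r, s) * v $ s)"
    unfolding scalar_prod_def atLeast0LessThan using assms by (intro sum.cong) auto
  finally show ?thesis .
qed

lemma query_mat_carrier: "query_mat N m X \<in> carrier_mat (2 ^ m) (2 ^ m)"
  by (simp add: query_mat_def)

lemma run_network_carrier: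
  assumes "\<And>j. j \<le> t \<Longrightarrow> U j \<in> carrier_mat (2 ^ m) (2 ^ m)"
  shows "run_network N m U X t \<in> carrier_vec (2 ^ m)"
proof (cases t)
  case 0
  thus ?thesis using assms[of 0] by (auto intro!: mult_mat_vec_carrier)
next
  case (Suc k)
  have "dim_row (U t) = 2 ^ m"
    using assms[OF order_refl] by (rule carrier_matD)
  thus ?thesis
    unfolding Suc by (intro carrier_vecI) (simp only: run_network.simps dim_mult_mat_vec)
qed

text \<open>Bridge from the sets on which \<open>degree_le\<close> is defined to Boolean inputs;
  elements of \<open>A\<close> that are at least \<open>N\<close> are ignored.\<close>

definition input_of_set :: "nat \<Rightarrow> nat set \<Rightarrow> bool list" where
  "input_of_set N A = map (\<lambda>i. i \<in> A) [0..<N]"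

lemma length_input_of_set [simp]: "length (input_of_set N A) = N"
  by (simp add: input_of_set_def)

lemma nth_input_of_set [simp]: "i < N \<Longrightarrow> input_of_set N A ! i \<longleftrightarrow> i \<in> A"
  by (simp add: input_of_set_def)

lemma OR_input_of_set: "OR (input_of_set N A) \<longleftrightarrow> A \<inter> {..<N} \<noteq> {}"
  by (auto simp: OR_def)

text \<open>Each matrix entry of the query depends on at most one input bit, so a query raises the
  degree by at most one. The matrices between queries act linearly with coefficients independent of
  the input.\<close>

lemma degree_le_run_network:
  assumes "\<And>j. j \<le> t \<Longrightarrow> U j \<in> carrier_mat (2 ^ m) (2 ^ m)" "r < 2 ^ m"
  shows "degree_le t (\<lambda>A. run_network N m U (input_of_set N A) t $ r)"
  using assms
proof (induction t arbitrary: r)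
  case 0
  show ?case using degree_le_const by simp
next
  case (Suc t)
  let ?\<psi> = "\<lambda>A. run_network N m U (input_of_set N A) t"
  let ?O = "\<lambda>A. query_mat N m (input_of_set N A)"
  have \<psi>: "?\<psi> A \<in> carrier_vec (2 ^ m)" for A
    using Suc.prems by (intro run_network_carrier) auto
  have entry: "degree_le (Suc t) (\<lambda>A. ?O A $$ (k, s) * ?\<psi> A $ s)"
    if ks: "k < 2 ^ m" "s < 2 ^ m" for k s
  proof -
    define w where "w = work_bits N m"
    define i where "i = s div 2 ^ Suc w"
    have query_index: "query_index N m X s = (if i < N \<and> X ! i then flip_bit w s else s)" for X
      unfolding query_index_def Let_def w_def[symmetric] i_def[symmetric] by (rule refl)
    have IH: "degree_le t (\<lambda>A. ?\<psi> A $ s)"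
      using Suc.prems ks by (intro Suc.IH) auto
    \<comment> \<open>For \<open>i < N\<close>, membership of \<open>i\<close> in \<open>A\<close>
      decides between the flipped and the unchanged basis state. For \<open>i \<ge> N\<close> the
      basis state stays unchanged, so \<open>?a\<close> must agree with \<open>?b\<close>, as
      \<open>A\<close> may contain such an \<open>i\<close>.\<close>
    let ?a = "of_bool (i < N \<and> k = flip_bit w s \<or> \<not> i < N \<and> k = s) :: complex"
    let ?b = "of_bool (k = s) :: complex"
    have "(\<lambda>A. ?O A $$ (k, s) * ?\<psi> A $ s) =
        (\<lambda>A. if i \<in> A then ?a * ?\<psi> A $ s else ?b * ?\<psi> A $ s)"
      using ks by (auto simp: fun_eq_iff query_mat_def query_index)
    thus ?thesis
      using IH by (simp only: degree_le_If_mem degree_le_mult_const)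
  qed
  \<comment> \<open>The factor \<open>1\<close> gives the inner sum the form required by
    \<open>degree_le_sum\<close>.\<close>
  have step: "run_network N m U (input_of_set N A) (Suc t) $ r =
      (\<Sum>k<2 ^ m. U (Suc t) $$ (r, k) * (\<Sum>s<2 ^ m. 1 * (?O A $$ (k, s) * ?\<psi> A $ s)))" for A
  proof -
    have "?O A *\<^sub>v ?\<psi> A \<in> carrier_vec (2 ^ m)"
      using query_mat_carrier \<psi> by (rule mult_mat_vec_carrier)
    hence "run_network N m U (input_of_set N A) (Suc t) $ r =
        (\<Sum>k<2 ^ m. U (Suc t) $$ (r, k) * (?O A *\<^sub>v ?\<psi> A) $ k)"
      using Suc.prems by (simp only: run_network.simps mult_mat_vec_nth[of _ "2 ^ m" "2 ^ m"])
    thus ?thesis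
      using \<psi>[of A] query_mat_carrier
      by (simp add: mult_mat_vec_nth[of _ "2 ^ m" "2 ^ m"] del: index_mult_mat_vec)
  qed
  show ?case
    unfolding step using entry by (intro degree_le_sum) auto
qed

section \<open>Norm preservation and outcome probabilities\<close>

lemma sum_norm_square_unitary:
  assumes U: "unitary_mat n U" and v: "v \<in> carrier_vec n"
  shows "(\<Sum>s<n. (cmod ((U *\<^sub>v v) $ s))\<^sup>2) = (\<Sum>s<n. (cmod (v $ s))\<^sup>2)"
proof -
  have Uc: "U \<in> carrier_mat n n" and UU: "mat_adjoint U * U = 1\<^sub>m n"
    using U by (auto simp: unitary_mat_def)
  have norm: "u \<bullet>c u = complex_of_real (\<Sum>s<n. (cmod (u $ s))\<^sup>2)" if "u \<in> carrier_vec n" for u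
    using that by (simp add: scalar_prod_def atLeast0LessThan complex_norm_square[symmetric] del: of_real_power)
  have Ac: "mat_adjoint U \<in> carrier_mat n n" using Uc by (auto simp: mat_adjoint_def)
  have "(U *\<^sub>v v) \<bullet>c (U *\<^sub>v v) = v \<bullet>c v"
  proof -
    \<comment> \<open>Moving \<open>U\<close> from the right argument to the left as its adjoint
      lets it cancel there.\<close>
    have "(U *\<^sub>v v) \<bullet>c (U *\<^sub>v v) = (mat_adjoint U *\<^sub>v (U *\<^sub>v v)) \<bullet>c v"
    proof -
      have adj: "mat_adjoint U $$ (k, s) = cnj (U $$ (s, k))" if "s < n" "k < n" for s k
        using Uc that by (simp add: mat_adjoint_def mat_of_rows_def)
      have "(U *\<^sub>v v) \<bullet>c (U *\<^sub>v v) =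
          (\<Sum>s<n. (U *\<^sub>v v) $ s * cnj (\<Sum>k<n. U $$ (s, k) * v $ k))"
        using Uc v by (auto simp: scalar_prod_def atLeast0LessThan intro!: sum.cong)
      also have "\<dots> = (\<Sum>k<n. (\<Sum>s<n. cnj (U $$ (s, k)) * (U *\<^sub>v v) $ s) * cnj (v $ k))"
        unfolding cnj_sum sum_distrib_left sum_distrib_right
        by (subst sum.swap) (simp add: ac_simps)
      also have "\<dots> = (\<Sum>k<n. (mat_adjoint U *\<^sub>v (U *\<^sub>v v)) $ k * cnj (v $ k))"
        using Ac Uc v by (intro sum.cong refl)
          (simp add: mult_mat_vec_nth[of _ n n] adj del: index_mult_mat_vec)
      also have "\<dots> = (mat_adjoint U *\<^sub>v (U *\<^sub>v v)) \<bullet>c v"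
        using v by (simp add: scalar_prod_def atLeast0LessThan)
      finally show ?thesis .
    qed
    also have "mat_adjoint U *\<^sub>v (U *\<^sub>v v) = v"
      using assoc_mult_mat_vec[OF Ac Uc v] UU v by simp
    finally show ?thesis .
  qed
  hence "complex_of_real (\<Sum>s<n. (cmod ((U *\<^sub>v v) $ s))\<^sup>2) = complex_of_real (\<Sum>s<n. (cmod (v $ s))\<^sup>2)"
    using norm[of v] norm[of "U *\<^sub>v v"] v Uc by simp
  thus ?thesis by (simp only: of_real_eq_iff)
qed

text \<open>No input bit is set, so a query flips nothing.\<close>

lemma query_mat_zero_input: "query_mat N m (input_of_set N {}) = 1\<^sub>m (2 ^ m)"
  by (rule eq_matI) (auto simp: query_mat_def query_index_def Let_def)

lemma sum_norm_square_run_network_zero_input: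
  assumes "\<And>j. j \<le> t \<Longrightarrow> unitary_mat (2 ^ m) (U j)"
  shows "(\<Sum>s<2 ^ m. (cmod (run_network N m U (input_of_set N {}) t $ s))\<^sup>2) = 1"
  using assms
proof (induction t)
  case 0
  have "(\<Sum>s<2 ^ m. (cmod (unit_vec (2 ^ m) 0 $ s))\<^sup>2) = (\<Sum>s<(2::nat) ^ m. if s = 0 then 1 else 0)"
    by (intro sum.cong) (auto simp: unit_vec_def)
  also have "\<dots> = 1"
    by simp
  finally show ?case
    using 0 by (simp add: sum_norm_square_unitary)
next
  case (Suc t)
  have "run_network N m U (input_of_set N {}) t \<in> carrier_vec (2 ^ m)"
    using Suc.prems by (intro run_network_carrier) (auto simp: unitary_mat_def)
  thus ?case
    using Suc by (simp add: query_mat_zero_input sum_norm_square_unitary)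
qed

lemma measure_prob_eq_0_iff:
  "measure_prob m \<psi> E = 0 \<longleftrightarrow> (\<forall>s<2 ^ m. E s \<longrightarrow> \<psi> $ s = 0)"
  unfolding measure_prob_def by (subst sum_nonneg_eq_0_iff) auto

text \<open>The inconclusive event merges two of the four patterns of the two rightmost bits; the
  two answers take one each of the others.\<close>

lemma measure_prob_total:
  "prob_inconclusive m \<psi> + prob_answer m \<psi> a + prob_answer m \<psi> (\<not> a) =
     (\<Sum>s<2 ^ m. (cmod (\<psi> $ s))\<^sup>2)"
proof -
  define I :: "nat set" where "I = {s. s < 2 ^ m \<and> \<not> bit s 1}"
  define J :: "bool \<Rightarrow> nat set" where "J c = {s. s < 2 ^ m \<and> bit s 1 \<and> bit s 0 = c}" for c
  have "{..<(2::nat) ^ m} = I \<union> J a \<union> J (\<not> a)" "I \<inter> J a = {}" "(I \<union> J a) \<inter> J (\<not> a) = {}"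
    "finite I" "finite (J c)" for c
    by (auto simp: I_def J_def)
  thus ?thesis
    unfolding prob_inconclusive_def prob_answer_def measure_prob_def I_def[symmetric] J_def[symmetric]
    by (simp add: sum.union_disjoint)
qed

lemma zero_error_OR_queries_ge:
  assumes net: "quantum_network N T m U" and comp: "computes_zero_error N T m U OR"
  shows "N \<le> T"
proof (rule ccontr)
  assume "\<not> N \<le> T"
  hence T: "T < card {..<N}" by simp
  have unitary: "unitary_mat (2 ^ m) (U j)" if "j \<le> T" for j
    using net that by (simp add: quantum_network_def)
  let ?\<psi> = "\<lambda>A. run_network N m U (input_of_set N A) T"
  have err: "prob_answer m (?\<psi> A) (\<not> OR (input_of_set N A)) = 0" for A
    using comp by (simp add: computes_zero_error_def)
  \<comment> \<open>Answer 0 is wrong at every nonzero input, and the difference is taken along all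
    \<open>N > T\<close> coordinates.\<close>
  have "?\<psi> {} $ s = 0" if s: "s < 2 ^ m" "bit s 1 \<and> bit s 0 = False" for s
  proof (rule degree_le_vanish_at_empty[where g = "\<lambda>A. ?\<psi> A $ s", OF _ _ T])
    show "degree_le T (\<lambda>A. ?\<psi> A $ s)"
      using s unitary by (intro degree_le_run_network) (auto simp: unitary_mat_def)
    fix A assume "A \<subseteq> {..<N}" "A \<noteq> {}"
    hence "OR (input_of_set N A)" by (auto simp: OR_input_of_set)
    hence "prob_answer m (?\<psi> A) False = 0" using err[of A] by simp
    thus "?\<psi> A $ s = 0"
      using s unfolding prob_answer_def measure_prob_eq_0_iff by blast
  qed simp
  hence "prob_answer m (?\<psi> {}) False = 0"
    unfolding prob_answer_def measure_prob_eq_0_iff by blast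
  \<comment> \<open>Answer 1 at the zero input is excluded directly by the zero-error
    condition.\<close>
  moreover have "prob_answer m (?\<psi> {}) True = 0"
    using err[of "{}"] by (simp add: OR_input_of_set)
  ultimately have "prob_inconclusive m (?\<psi> {}) = 1"
    using measure_prob_total[of m "?\<psi> {}" True] unitary
    by (simp add: sum_norm_square_run_network_zero_input)
  moreover have "prob_inconclusive m (?\<psi> {}) < 1 / 2"
    using comp by (simp add: computes_zero_error_def)
  ultimately show False by simp
qed

section \<open>Upper bound\<close>

text \<open>The complements of the two images in \<open>S\<close> have equal size, so any bijection
  between them completes the prescribed map from \<open>e a\<close> to \<open>g a\<close>.\<close>

lemma bij_betw_extend:
  assumes "finite S" "inj_on e A" "inj_on g A" "e ` A \<subseteq> S" "g ` A \<subseteq> S"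
  obtains p where "bij_betw p S S" "\<And>a. a \<in> A \<Longrightarrow> p (e a) = g a"
proof -
  have "card (S - e ` A) = card (S - g ` A)"
    using assms by (simp add: card_Diff_subset finite_subset card_image)
  then obtain q where q: "bij_betw q (S - e ` A) (S - g ` A)"
    using assms(1) finite_same_card_bij[of "S - e ` A" "S - g ` A"] by blast
  define h where "h = g \<circ> the_inv_into A e"
  have h: "bij_betw h (e ` A) (g ` A)"
    unfolding h_def using assms
    by (intro bij_betw_trans[where B = A]) (auto simp: bij_betw_the_inv_into bij_betw_def inj_on_the_inv_into)
  define p where "p x = (if x \<in> e ` A then h x else q x)" for x
  have "bij_betw p (e ` A \<union> (S - e ` A)) (g ` A \<union> (S - g ` A))"
    unfolding p_def using h q by (rule bij_betw_disjoint_Un) auto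
  hence "bij_betw p S S"
    using assms by (simp add: Un_absorb1)
  moreover have "p (e a) = g a" if "a \<in> A" for a
    using that assms by (simp add: p_def h_def the_inv_into_f_f)
  ultimately show ?thesis by (rule that)
qed

text \<open>The columns are the unit vectors permuted by \<open>p\<close>, hence orthonormal; for
  square matrices a left inverse is also a right inverse.\<close>

lemma unitary_mat_permutation:
  assumes p: "bij_betw p {..<n} {..<n}"
  shows "unitary_mat n (mat n n (\<lambda>(r, s). if r = p s then 1 else 0))" (is "unitary_mat n ?P")
proof -
  have pn: "p s < n" if "s < n" for s
    using p that by (auto simp: bij_betw_def)
  have inj: "p s = p s' \<longleftrightarrow> s = s'" if "s < n" "s' < n" for s s'
    using p that by (auto simp: bij_betw_def inj_on_def)
  have adj: "mat_adjoint ?P = mat n n (\<lambda>(r, s). if s = p r then 1 else 0)"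
    by (rule eq_matI) (auto simp: mat_adjoint_def mat_of_rows_def)
  have "mat_adjoint ?P * ?P = 1\<^sub>m n"
    unfolding adj
    by (rule eq_matI) (auto simp: scalar_prod_def pn inj if_distrib[where f = "\<lambda>x. x * _"] cong: if_cong)
  moreover from this have "?P * mat_adjoint ?P = 1\<^sub>m n"
    by (intro mat_mult_left_right_inverse[of "mat_adjoint ?P" n]) (auto simp: adj)
  ultimately show ?thesis
    by (simp add: unitary_mat_def)
qed

lemma unitary_mat_one: "unitary_mat n (1\<^sub>m n)"
  using unitary_mat_permutation[of id n] by (simp add: one_mat_def)

text \<open>Allows a gate to be specified only on the basis states that can occur: an injective
  assignment there extends to a permutation of all basis states.\<close>

lemma ex_unitary_mat_unit_vec:
  assumes "inj_on e A" "inj_on g A" "e ` A \<subseteq> {..<n}" "g ` A \<subseteq> {..<n}"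
  shows "\<exists>U. unitary_mat n U \<and> (\<forall>a\<in>A. U *\<^sub>v unit_vec n (e a) = unit_vec n (g a))"
proof -
  obtain p where p: "bij_betw p {..<n} {..<n}" and pe: "\<And>a. a \<in> A \<Longrightarrow> p (e a) = g a"
    using bij_betw_extend[of "{..<n}" e A g] assms by auto
  let ?P = "mat n n (\<lambda>(r, s). if r = p s then 1 else 0) :: complex mat"
  have "?P *\<^sub>v unit_vec n (e a) = unit_vec n (g a)" if "a \<in> A" for a
  proof -
    have "e a < n" using assms that by auto
    thus ?thesis
      using pe[OF that] by (intro eq_vecI) (auto simp: unit_vec_def scalar_prod_def
          if_distrib[where f = "\<lambda>x. _ * x"] cong: if_cong)
  qed
  thus ?thesis using unitary_mat_permutation[OF p] by blast
qed

section \<open>A network that reads all input bits\<close>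

fun read_bits :: "bool list \<Rightarrow> nat \<Rightarrow> nat" where
  "read_bits X 0 = 0"
| "read_bits X (Suc t) = 2 * read_bits X t + of_bool (X ! t)"

lemma read_bits_less: "read_bits X t < 2 ^ t"
  by (induction t) (auto simp: of_bool_def)

lemma read_bits_pos_iff: "read_bits X t > 0 \<longleftrightarrow> (\<exists>i<t. X ! i)"
  by (induction t) (auto simp: less_Suc_eq)

text \<open>Before the query of bit t the state is |t, 0, z>, where z is the binary number formed by
  the first t input bits. The query puts x_t into the query bit; the next unitary moves it to the
  end of z, clears the query bit and advances the index. Nothing read is lost, so each such map is
  injective.\<close>

lemma zero_error_OR_network:
  assumes N: "N \<ge> 1"
  shows "\<exists>m U. quantum_network N N m U \<and> computes_zero_error N N m U OR"
proof -
  \<comment> \<open>\<open>N\<close> qubits for the bits read and two for the output.\<close>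
  define w where "w = N + 2"
  define m where "m = ceillog2 N + 1 + w"
  have wb: "work_bits N m = w" by (simp add: work_bits_def m_def)
  define pos where "pos i b z = i * 2 ^ Suc w + of_bool b * 2 ^ w + z" for i z :: nat and b
  \<comment> \<open>The bits read move up two places to make room for the output: the summand 2
    marks it as conclusive, and the lowest bit is the answer. Keeping \<open>z\<close> makes the map
    injective.\<close>
  define final where "final z = 4 * z + 2 + of_bool (z > 0)" for z :: nat
  have ket: "ket N m i b z = unit_vec (2 ^ m) (pos i b z)" for i b z
    by (simp add: ket_def wb pos_def)
  have Nle: "N \<le> 2 ^ ceillog2 N" using N by (simp add: le_two_power_ceillog2)
  have pos_less: "pos i b z < 2 ^ m" if "i < N" "z < 2 ^ w" for i b z
  proof -
    have "pos i b z < (i + 1) * 2 ^ Suc w" using that by (cases b) (auto simp: pos_def)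
    also have "\<dots> \<le> 2 ^ ceillog2 N * 2 ^ Suc w" using that Nle by (intro mult_right_mono) auto
    finally show ?thesis by (simp add: m_def power_add)
  qed
  have pos_inj: "inj_on (\<lambda>(b, z). pos i b z) (UNIV \<times> {..<2 ^ t})" if "t \<le> w" for i t
  proof -
    have "z < 2 ^ w" if "z < 2 ^ t" for z :: nat
      using that \<open>t \<le> w\<close> power_increasing[of t w "2::nat"] by linarith
    thus ?thesis by (auto simp: inj_on_def pos_def of_bool_def split: if_splits)
  qed
  have step_bound: "2 * z + of_bool b < (2::nat) ^ Suc t" if "z < 2 ^ t" for z t b
    using that by (cases b) auto
  have final_less: "final z < 2 ^ w" if "z < 2 ^ N" for z
    using that by (auto simp: final_def w_def)
  have bound: "z < 2 ^ w" if "z < 2 ^ t" "t \<le> N" for z t :: nat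
    using that power_increasing[of t w "2::nat"] by (simp add: w_def)
  \<comment> \<open>After the last query there is no further index to move to, so the output is
    written instead.\<close>
  define target where "target t b z =
      (if Suc t < N then pos (Suc t) False (2 * z + of_bool b) else final (2 * z + of_bool b))"
    for t z :: nat and b
  \<comment> \<open>Appending a bit loses nothing; \<open>target\<close> inherits its injectivity
    from this.\<close>
  have double: "b = b' \<and> z = z'" if "2 * z + of_bool b = 2 * z' + of_bool b'" for z z' :: nat and b b'
    using that by (cases b; cases b'; simp; presburger)
  have final_inj: "final z = final z' \<longleftrightarrow> z = z'" for z z'
    by (cases "z > 0"; cases "z' > 0") (auto simp: final_def)
  have ex: "\<exists>V. unitary_mat (2 ^ m) V \<and> (\<forall>b z. z < 2 ^ t \<longrightarrow>
      V *\<^sub>v unit_vec (2 ^ m) (pos t b z) = unit_vec (2 ^ m) (target t b z))" if t: "t < N" for t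
  proof -
    have "b = b' \<and> z = z'" if "target t b z = target t b' z'" for b z b' z'
    proof (rule double)
      show "2 * z + of_bool b = 2 * z' + of_bool b'"
        using that by (cases "Suc t < N")
          (simp_all only: target_def pos_def final_inj if_True if_False add_left_cancel)
    qed
    hence target_inj: "inj_on (\<lambda>(b, z). target t b z) (UNIV \<times> {..<2 ^ t})"
      by (simp add: inj_on_def)
    have target_less: "target t b z < 2 ^ m" if "z < 2 ^ t" for b z
    proof (cases "Suc t < N")
      case True
      hence "pos (Suc t) False (2 * z + of_bool b) < 2 ^ m"
        using bound[OF step_bound[OF that]] by (intro pos_less) simp_all
      thus ?thesis using True by (simp add: target_def)
    next
      case False
      hence "Suc t = N" using t by simp
      hence "final (2 * z + of_bool b) < 2 ^ w" using step_bound[OF that, of b] final_less by metis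
      also have "\<dots> \<le> 2 ^ m" by (intro power_increasing) (simp_all add: m_def)
      finally show ?thesis using False by (simp add: target_def)
    qed
    have pos_t_less: "pos t b z < 2 ^ m" if "z < 2 ^ t" for b z
      using pos_less t bound[OF that] by simp
    have "\<exists>V. unitary_mat (2 ^ m) V \<and> (\<forall>a\<in>UNIV \<times> {..<2 ^ t}.
        V *\<^sub>v unit_vec (2 ^ m) (case a of (b, z) \<Rightarrow> pos t b z) =
          unit_vec (2 ^ m) (case a of (b, z) \<Rightarrow> target t b z))"
      using t target_less pos_t_less
      by (intro ex_unitary_mat_unit_vec target_inj pos_inj) (auto simp: w_def)
    thus ?thesis
      by (simp add: Ball_def)
  qed
  then obtain V where V: "\<And>t. t < N \<Longrightarrow> unitary_mat (2 ^ m) (V t)"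
    and V_pos: "\<And>t b z. t < N \<Longrightarrow> z < 2 ^ t \<Longrightarrow>
      V t *\<^sub>v unit_vec (2 ^ m) (pos t b z) = unit_vec (2 ^ m) (target t b z)"
    by metis
  \<comment> \<open>\<open>V t\<close> follows the query of bit \<open>t\<close>, hence the shift by
    one; \<open>U 0\<close> is the identity because the initial state is already |0, 0, 0>.\<close>
  define U where "U j = (case j of 0 \<Rightarrow> 1\<^sub>m (2 ^ m) | Suc t \<Rightarrow> V t)" for j
  have net: "quantum_network N N m U"
    unfolding quantum_network_def
  proof (intro conjI allI impI)
    show "unitary_mat (2 ^ m) (U j)" if "j \<le> N" for j
      using V unitary_mat_one that by (cases j) (simp_all add: U_def)
  qed (simp_all add: m_def w_def)
  have query: "run_network N m U X (Suc t) = unit_vec (2 ^ m) (target t (X ! t) (read_bits X t))"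
    if t: "t < N" and run: "run_network N m U X t = ket N m t False (read_bits X t)" for X t
  proof -
    have "query_mat N m X *\<^sub>v ket N m t False (read_bits X t) = ket N m t (X ! t) (read_bits X t)"
      using query_mat_ket[of N m t "read_bits X t" X False] t Nle bound[OF read_bits_less, of t X]
      by (simp add: wb) (simp add: m_def)
    thus ?thesis
      using run V_pos[OF t read_bits_less] by (simp add: U_def ket)
  qed
  have run: "run_network N m U X t = ket N m t False (read_bits X t)" if "t < N" for X t
    using that
  proof (induction t)
    case 0
    show ?case by (simp add: U_def ket pos_def)
  next
    case (Suc t)
    thus ?case using query[of t X] by (simp add: target_def ket)
  qed
  have run_N: "run_network N m U X N = unit_vec (2 ^ m) (final (read_bits X N))" for X
  proof -
    obtain t where t: "N = Suc t" using N by (cases N) auto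
    show ?thesis using query[OF _ run, of t X] t by (simp add: target_def)
  qed
  have "computes_zero_error N N m U OR"
    unfolding computes_zero_error_def
  proof (intro allI impI)
    fix X :: "bool list"
    assume X: "length X = N"
    let ?s = "final (read_bits X N)"
    have OR: "OR X \<longleftrightarrow> read_bits X N > 0"
      by (simp add: OR_def X read_bits_pos_iff)
    have bits: "bit ?s 1" "bit ?s 0 \<longleftrightarrow> OR X"
      unfolding OR by (auto simp: final_def bit_iff_odd)
    \<comment> \<open>The final state is a single basis state, so every event that excludes it has
      probability 0. This covers both the wrong answer and the inconclusive one.\<close>
    have "measure_prob m (unit_vec (2 ^ m) ?s) E = 0" if "\<not> E ?s" for E
      unfolding measure_prob_eq_0_iff using that by (auto simp: unit_vec_def)
    with bits show "prob_answer m (run_network N m U X N) (\<not> OR X) = 0 \<and>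
        prob_inconclusive m (run_network N m U X N) < 1 / 2"
      by (simp add: run_N prob_answer_def prob_inconclusive_def)
  qed
  with net show ?thesis by blast
qed

theorem proposition6p1:
  fixes N :: nat
  assumes "N \<ge> 1"
  shows "Q0 N OR = N"
  unfolding Q0_def
proof (rule Least_equality)
  show "\<exists>m U. quantum_network N N m U \<and> computes_zero_error N N m U OR"
    using zero_error_OR_network assms .
  show "N \<le> T" if "\<exists>m U. quantum_network N T m U \<and> computes_zero_error N T m U OR" for T
    using that zero_error_OR_queries_ge by blast
qed

end
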